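(* Let $w(se^{i\theta})=\omega(s)v(\theta)$, $0<s<1$, $0\le\theta<2\pi$, where $\omega$ and $v$ are two weights (positive measurable functions on $(0,1)$ and $[0,2\pi)$ respectively) satisfying $$\int_0^1 s\,\omega(s)\,ds<\infty,\qquad \int_0^{2\pi}v(\theta)\,d\theta<\infty,$$ and suppose that for some integer $k\ge 0$, some constant $C$ and some $r_0\in(0,1)$, $$r^k\omega\left(\frac{s}{r}\right)\le C\,\omega(s)\qquad\text{for all } r\in[r_0,1) \text{ and all } 0<s<r.$$ Then the polynomials are dense in the weighted Bergman space $A^p(\mathbb{D},w\,dA)$ for every $0<p<\infty$.
   Context: $\mathbb{D}=\{z\in\mathbb{C}:|z|<1\}$ and $dA(z)=dx\,dy$ is planar Lebesgue measure. For $0<p<\infty$, the weighted Bergman space $A^p(\mathbb{D},w\,dA)$ is the space of analytic functions $f$ on $\mathbb{D}$ with $\|f\|^p_{A^p(\mathbb{D},w\,dA)}=\int_{\mathbb{D}}|f(z)|^p w(z)\,dA(z)<\infty$. The value of $w$ at the origin is immaterial. Polynomials means analytic polynomials (in $z$, complex coefficients). Density means: for every $f$ in the space and every $\varepsilon>0$ there is a polynomial $Q$ with $\|f-Q\|_{A^p(\mathbb{D},w\,dA)}<\varepsilon$. *)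

theory Defs
  imports "HOL-Complex_Analysis.Complex_Analysis"
begin

text \<open>Elements of the Bergman space are represented by total functions on the complex plane;
  only their values on the unit disc are ever used. \<open>dA\<close> is Lebesgue measure on the plane
  (not normalised).\<close>

definition bergman_space :: "real \<Rightarrow> (complex \<Rightarrow> real) \<Rightarrow> (complex \<Rightarrow> complex) set" where
  "bergman_space p w = {f. f holomorphic_on ball 0 1 \<and>
     set_integrable lebesgue (ball 0 1) (\<lambda>z. cmod (f z) powr p * w z)}"

text \<open>For \<open>p < 1\<close> this is only a quasi-norm. The integral is a Bochner integral, so the value is
  meaningful only for members of \<open>bergman_space p w\<close>.\<close>

definition bergman_norm :: "real \<Rightarrow> (complex \<Rightarrow> real) \<Rightarrow> (complex \<Rightarrow> complex) \<Rightarrow> real" where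
  "bergman_norm p w f = (LINT z:ball 0 1|lebesgue. cmod (f z) powr p * w z) powr (1 / p)"

text \<open>The membership conditions on \<open>poly Q\<close> and on the difference express that the (quasi-)norm of
  the difference is finite; without them a divergent integral, whose value is \<open>0\<close> by convention,
  would count as small.\<close>

definition polynomials_dense :: "real \<Rightarrow> (complex \<Rightarrow> real) \<Rightarrow> bool" where
  "polynomials_dense p w \<longleftrightarrow>
     (\<forall>f\<in>bergman_space p w. \<forall>\<epsilon>>0. \<exists>Q :: complex poly.
        poly Q \<in> bergman_space p w \<and>
        (\<lambda>z. f z - poly Q z) \<in> bergman_space p w \<and>
        bergman_norm p w (\<lambda>z. f z - poly Q z) < \<epsilon>)"

end

theory Submission
  imports Defs
begin

text \<open>
  Write \<open>f\<^sub>r(z) = f (r z)\<close> for the dilates of \<open>f\<close>. For \<open>r < 1\<close> the dilate is holomorphic on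
  a neighbourhood of the closed disc, so its Taylor polynomials converge to it uniformly there, and
  therefore also in the weighted norm as soon as \<open>w\<close> is integrable over the disc. Density of the
  polynomials thus reduces to \<open>f\<^sub>r \<rightarrow> f\<close> in norm as \<open>r \<rightarrow> 1\<close>.

  Locally uniform convergence settles every disc \<open>|z| \<le> R < 1\<close>, and what could fail is that the
  dilates carry mass to the circle. Here the growth condition enters. With \<open>\<zeta> = r z\<close>, the integral
  of \<open>|f\<^sub>r|\<^sup>p w\<close> over \<open>R < |z| < 1\<close> is that of \<open>|f(\<zeta>)|\<^sup>p w(\<zeta> / r) / r\<^sup>2\<close> over
  \<open>r R < |\<zeta>| < r\<close>, and \<open>w (\<zeta> / r) \<le> C w(\<zeta>) / r ^ k\<close> bounds it by a constant times the
  mass of \<open>f\<close> in \<open>|\<zeta>| > r R\<close> (\<open>dilation_tail_bound\<close>). As \<open>|f|\<^sup>p w\<close> is integrable, this is small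
  for \<open>R\<close> near \<open>1\<close>, uniformly in \<open>r\<close> near \<open>1\<close> (\<open>dilation_arbitrarily_close\<close>). The argument is
  written for any nonnegative integrable \<open>w\<close> with such a growth condition along rays
  (\<open>polynomials_dense_of_dilation_bound\<close>).

  The product form of \<open>w\<close> serves to verify these hypotheses: the growth condition passes from
  \<open>\<omega>\<close> to \<open>w\<close> because dilations do not change the angle, and integrability over the disc comes from
  polar coordinates, which turn the integral of \<open>w\<close> into the product of the integrals of
  \<open>s \<omega>(s)\<close> and \<open>v\<close> (\<open>set_integrable_polar_product\<close>). The polar integration formula for
  nonnegative Borel functions is derived from Fubini's theorem.
\<close>

section \<open>Polar coordinates\<close>

text \<open>This is the substitution \<open>t = cot \<theta>\<close>, \<open>dt = - d\<theta> / sin\<^sup>2 \<theta>\<close> in measure form, which lets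
  it act on arbitrary nonnegative Borel integrands. By uniqueness of Lebesgue measure it is enough to
  measure intervals, where the fundamental theorem of calculus for \<open>- cot\<close> applies.\<close>

lemma lborel_distr_cot:
  "distr (density lborel (\<lambda>\<theta>. ennreal (1 / (sin \<theta>)\<^sup>2) * indicator {0<..<pi} \<theta>)) borel cot = (lborel :: real measure)"
proof (rule lborel_eqI[symmetric])
  fix l u :: real
  assume "\<And>b. b \<in> Basis \<Longrightarrow> l \<bullet> b \<le> u \<bullet> b"
  then have lu: "l \<le> u" by simp
  have [measurable]: "cot \<in> borel_measurable (borel :: real measure)"
    unfolding cot_def by measurable
  have vim: "cot -` box l u \<in> sets borel"
    using measurable_sets[of cot borel borel "box l u"] by simp
  have cot_tan: "cot \<theta> = tan (pi / 2 - \<theta>)" for \<theta> :: real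
    by (simp add: cot_def tan_def cos_diff sin_diff)
  define a where "a = pi / 2 - arctan u"
  define b where "b = pi / 2 - arctan l"
  have a0: "0 < a" and bpi: "b < pi"
    using arctan_bounded[of u] arctan_bounded[of l] by (auto simp: a_def b_def)
  have ab: "a \<le> b" using lu by (simp add: a_def b_def arctan_le_iff)
  have iff: "(\<theta> \<in> {0<..<pi} \<and> cot \<theta> \<in> box l u) \<longleftrightarrow> \<theta> \<in> {a<..<b}" for \<theta>
  proof -
    have "cot \<theta> \<in> box l u \<longleftrightarrow> \<theta> \<in> {a<..<b}" if "\<theta> \<in> {0<..<pi}"
    proof -
      have t: "arctan (cot \<theta>) = pi / 2 - \<theta>"
        unfolding cot_tan using that by (intro arctan_tan) auto
      have "cot \<theta> \<in> box l u \<longleftrightarrow> arctan l < arctan (cot \<theta>) \<and> arctan (cot \<theta>) < arctan u"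
        by (simp add: arctan_less_iff)
      then show ?thesis by (auto simp: t a_def b_def)
    qed
    then show ?thesis using a0 bpi by auto
  qed
  have sin_pos: "sin \<theta> > 0" if "\<theta> \<in> {a..b}" for \<theta>
    using that a0 bpi by (intro sin_gt_zero) auto
  have "emeasure (distr (density lborel (\<lambda>\<theta>. ennreal (1 / (sin \<theta>)\<^sup>2) * indicator {0<..<pi} \<theta>)) borel cot) (box l u)
      = (\<integral>\<^sup>+\<theta>. ennreal (1 / (sin \<theta>)\<^sup>2) * indicator {0<..<pi} \<theta> * indicator (cot -` box l u) \<theta> \<partial>lborel)"
    using vim by (simp add: emeasure_distr emeasure_density del: box_real)
  also have "\<dots> = (\<integral>\<^sup>+\<theta>. ennreal (1 / (sin \<theta>)\<^sup>2) * indicator {a..b} \<theta> \<partial>lborel)"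
    using AE_lborel_singleton[of a] AE_lborel_singleton[of b]
  proof (intro nn_integral_cong_AE, eventually_elim)
    case (elim \<theta>)
    then have "\<theta> \<in> {a..b} \<longleftrightarrow> \<theta> \<in> {0<..<pi} \<and> \<theta> \<in> cot -` box l u"
      unfolding vimage_eq iff by auto
    then show ?case
      by (cases "\<theta> \<in> {a..b}") (auto simp only: indicator_simps vimage_eq mult_1_right mult_zero_right split: split_indicator)
  qed
  also have "\<dots> = ennreal ((- cot b) - (- cot a))"
  proof (rule nn_integral_FTC_Icc[OF _ _ _ ab])
    fix \<theta> assume "\<theta> \<in> {a..b}"
    then have "sin \<theta> \<noteq> 0" using sin_pos by force
    from DERIV_minus[OF DERIV_cot[OF this]]
    show "((\<lambda>\<theta>. - cot \<theta>) has_real_derivative 1 / (sin \<theta>)\<^sup>2) (at \<theta>)"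
      by (simp add: divide_inverse)
  qed simp_all
  also have "(- cot b) - (- cot a) = u - l"
    by (simp add: cot_tan a_def b_def tan_arctan)
  finally show "emeasure (distr (density lborel (\<lambda>\<theta>. ennreal (1 / (sin \<theta>)\<^sup>2) * indicator {0<..<pi} \<theta>)) borel cot) (box l u)
      = ennreal (\<Prod>b\<in>Basis. (u - l) \<bullet> b)" by simp
qed simp

lemma lborel_complex: "(lborel :: complex measure) = distr (lborel \<Otimes>\<^sub>M lborel) borel (\<lambda>(x, y). Complex x y)"
proof (rule lborel_eqI)
  fix l u :: complex
  assume le: "\<And>b. b \<in> Basis \<Longrightarrow> l \<bullet> b \<le> u \<bullet> b"
  have lu: "Re l \<le> Re u" "Im l \<le> Im u"
    using le[of 1] le[of \<i>] by (auto simp: Basis_complex_def inner_complex_def)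
  have vim: "(\<lambda>(x, y). Complex x y) -` box l u = {Re l<..<Re u} \<times> {Im l<..<Im u}"
    by (auto simp: box_def Basis_complex_def inner_complex_def)
  have [measurable]: "(\<lambda>(x, y). Complex x y) \<in> borel_measurable (lborel \<Otimes>\<^sub>M lborel)"
    unfolding Complex_eq by measurable
  show "emeasure (distr (lborel \<Otimes>\<^sub>M lborel) borel (\<lambda>(x, y). Complex x y)) (box l u)
      = ennreal (\<Prod>b\<in>Basis. (u - l) \<bullet> b)"
    using lu by (simp add: emeasure_distr vim space_pair_measure lborel.emeasure_pair_measure_Times
        Basis_complex_def inner_complex_def ennreal_mult)
qed simp

lemma nn_integral_lborel_complex:
  assumes [measurable]: "g \<in> borel_measurable borel"
  shows "(\<integral>\<^sup>+z. g z \<partial>lborel) = (\<integral>\<^sup>+y. \<integral>\<^sup>+x. g (Complex x y) \<partial>lborel \<partial>lborel)"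
proof -
  have [measurable]: "(\<lambda>(x, y). Complex x y) \<in> borel_measurable (lborel \<Otimes>\<^sub>M lborel)"
    unfolding Complex_eq by measurable
  have "(\<integral>\<^sup>+z. g z \<partial>lborel) = (\<integral>\<^sup>+p. g (case p of (x, y) \<Rightarrow> Complex x y) \<partial>(lborel \<Otimes>\<^sub>M lborel))"
    by (subst lborel_complex, subst nn_integral_distr) simp_all
  also have "\<dots> = (\<integral>\<^sup>+y. \<integral>\<^sup>+x. g (case (x, y) of (x, y) \<Rightarrow> Complex x y) \<partial>lborel \<partial>lborel)"
    by (rule lborel_pair.nn_integral_snd[symmetric]) measurable
  finally show ?thesis by simp
qed

text \<open>Polar coordinates are reached through one-dimensional substitutions only: on each horizontal
  line \<open>Im z = y > 0\<close> put \<open>x = y t\<close>, exchange the integrals, put \<open>t = cot \<theta>\<close>, and on the ray of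
  angle \<open>\<theta>\<close> put \<open>y = s sin \<theta>\<close>. The factors \<open>y\<close>, \<open>1 / sin\<^sup>2 \<theta>\<close> and \<open>sin \<theta>\<close> combine to the
  Jacobian \<open>s\<close>. The cotangent maps \<open>(0, \<pi>)\<close> onto the whole line, so that the upper half-plane is
  covered by one chart.\<close>

lemma nn_integral_polar_upper:
  fixes g :: "complex \<Rightarrow> ennreal"
  assumes [measurable]: "g \<in> borel_measurable borel"
  shows "(\<integral>\<^sup>+z. g z * indicator {z. Im z > 0} z \<partial>lborel)
    = (\<integral>\<^sup>+\<theta>. (\<integral>\<^sup>+s. g (of_real s * cis \<theta>) * ennreal s * indicator {0<..} s \<partial>lborel) * indicator {0<..<pi} \<theta> \<partial>lborel)"
proof -
  define I where "I = (indicator {0<..} :: real \<Rightarrow> ennreal)"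
  have [measurable]: "I \<in> borel_measurable borel" unfolding I_def by measurable
  have [measurable]: "cot \<in> borel_measurable (borel :: real measure)"
    unfolding cot_def by measurable
  have Cm [measurable (raw)]: "(\<lambda>p. Complex (a p) (b p)) \<in> borel_measurable M"
    if [measurable]: "a \<in> borel_measurable M" "b \<in> borel_measurable M" for M :: "'m measure" and a b
    unfolding Complex_eq by measurable
  have "(\<integral>\<^sup>+z. g z * indicator {z. Im z > 0} z \<partial>lborel)
     = (\<integral>\<^sup>+y. \<integral>\<^sup>+x. g (Complex x y) * I y \<partial>lborel \<partial>lborel)"
    by (subst nn_integral_lborel_complex) (auto simp: I_def indicator_def)
  also have "\<dots> = (\<integral>\<^sup>+y. \<integral>\<^sup>+t. g (Complex (y * t) y) * ennreal y * I y \<partial>lborel \<partial>lborel)"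
  proof (rule nn_integral_cong)
    fix y :: real
    show "(\<integral>\<^sup>+x. g (Complex x y) * I y \<partial>lborel) = (\<integral>\<^sup>+t. g (Complex (y * t) y) * ennreal y * I y \<partial>lborel)"
    proof (cases "y > 0")
      case True
      then show ?thesis
        by (subst nn_integral_real_affine[where c = y and t = 0])
           (auto simp: nn_integral_cmult[symmetric] ac_simps)
    qed (simp add: I_def)
  qed
  also have "\<dots> = (\<integral>\<^sup>+t. \<integral>\<^sup>+y. g (Complex (y * t) y) * ennreal y * I y \<partial>lborel \<partial>lborel)"
    by (rule lborel_pair.Fubini') measurable
  also have "\<dots> = (\<integral>\<^sup>+t. \<integral>\<^sup>+y. g (Complex (y * t) y) * ennreal y * I y \<partial>lborel
      \<partial>distr (density lborel (\<lambda>\<theta>. ennreal (1 / (sin \<theta>)\<^sup>2) * indicator {0<..<pi} \<theta>)) borel cot)"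
    by (simp add: lborel_distr_cot)
  also have "\<dots> = (\<integral>\<^sup>+\<theta>. ennreal (1 / (sin \<theta>)\<^sup>2) * indicator {0<..<pi} \<theta> *
       (\<integral>\<^sup>+y. g (Complex (y * cot \<theta>) y) * ennreal y * I y \<partial>lborel) \<partial>lborel)"
    by (simp add: nn_integral_distr nn_integral_density)
  also have "\<dots> = (\<integral>\<^sup>+\<theta>. (\<integral>\<^sup>+s. g (of_real s * cis \<theta>) * ennreal s * I s \<partial>lborel) * indicator {0<..<pi} \<theta> \<partial>lborel)"
  proof (rule nn_integral_cong)
    fix \<theta> :: real
    show "ennreal (1 / (sin \<theta>)\<^sup>2) * indicator {0<..<pi} \<theta> * (\<integral>\<^sup>+y. g (Complex (y * cot \<theta>) y) * ennreal y * I y \<partial>lborel)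
       = (\<integral>\<^sup>+s. g (of_real s * cis \<theta>) * ennreal s * I s \<partial>lborel) * indicator {0<..<pi} \<theta>"
    proof (cases "\<theta> \<in> {0<..<pi}")
      case True
      then have sp: "sin \<theta> > 0" by (auto intro: sin_gt_zero)
      have "(\<integral>\<^sup>+y. g (Complex (y * cot \<theta>) y) * ennreal y * I y \<partial>lborel)
        = ennreal (sin \<theta>) * (\<integral>\<^sup>+s. g (Complex (sin \<theta> * s * cot \<theta>) (sin \<theta> * s)) * ennreal (sin \<theta> * s) * I (sin \<theta> * s) \<partial>lborel)"
        using sp by (subst nn_integral_real_affine[where c = "sin \<theta>" and t = 0]) auto
      also have "(\<integral>\<^sup>+s. g (Complex (sin \<theta> * s * cot \<theta>) (sin \<theta> * s)) * ennreal (sin \<theta> * s) * I (sin \<theta> * s) \<partial>lborel)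
         = (\<integral>\<^sup>+s. ennreal (sin \<theta>) * (g (of_real s * cis \<theta>) * ennreal s * I s) \<partial>lborel)"
      proof (rule nn_integral_cong)
        fix s :: real
        have "Complex (sin \<theta> * s * cot \<theta>) (sin \<theta> * s) = of_real s * cis \<theta>"
          using sp by (simp add: complex_eq_iff cot_def)
        moreover have "ennreal (sin \<theta> * s) * I (sin \<theta> * s) = ennreal (sin \<theta>) * (ennreal s * I s)"
          using sp by (simp add: I_def indicator_def zero_less_mult_iff ennreal_mult)
        ultimately show "g (Complex (sin \<theta> * s * cot \<theta>) (sin \<theta> * s)) * ennreal (sin \<theta> * s) * I (sin \<theta> * s)
           = ennreal (sin \<theta>) * (g (of_real s * cis \<theta>) * ennreal s * I s)"
          by (simp add: mult.assoc mult.left_commute)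
      qed
      also have "\<dots> = ennreal (sin \<theta>) * (\<integral>\<^sup>+s. g (of_real s * cis \<theta>) * ennreal s * I s \<partial>lborel)"
        by (rule nn_integral_cmult) (simp add: cis.ctr)
      finally show ?thesis
        using True sp by (simp add: mult.assoc[symmetric] ennreal_mult[symmetric] power2_eq_square)
    qed simp
  qed
  finally show ?thesis unfolding I_def .
qed

text \<open>The lower half-plane is carried to the upper one by \<open>z \<mapsto> - z\<close>, which shifts the angle by \<open>\<pi>\<close>;
  the real axis is a null set.\<close>

theorem nn_integral_polar:
  fixes g :: "complex \<Rightarrow> ennreal"
  assumes [measurable]: "g \<in> borel_measurable borel"
  shows "(\<integral>\<^sup>+z. g z \<partial>lborel) =
    (\<integral>\<^sup>+\<theta>. (\<integral>\<^sup>+s. g (of_real s * cis \<theta>) * ennreal s * indicator {0<..} s \<partial>lborel) * indicator {0..<2 * pi} \<theta> \<partial>lborel)"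
proof -
  define G where "G \<theta> = (\<integral>\<^sup>+s. g (of_real s * cis \<theta>) * ennreal s * indicator {0<..} s \<partial>lborel)" for \<theta>
  have [measurable]: "cis \<in> borel_measurable borel"
    by (intro borel_measurable_continuous_onI continuous_intros)
  have [measurable]: "G \<in> borel_measurable borel"
    unfolding G_def by measurable
  have neg: "distr lborel borel uminus = (lborel :: complex measure)"
    using lborel_affine[of "-1" "0::complex"] by (simp add: density_1)
  have "(\<integral>\<^sup>+z. g z * indicator {z. Im z < 0} z \<partial>lborel)
     = (\<integral>\<^sup>+z. g (- z) * indicator {z. Im z > 0} z \<partial>lborel)"
    by (subst neg[symmetric], subst nn_integral_distr) (auto simp: indicator_def intro!: nn_integral_cong)
  also have "\<dots> = (\<integral>\<^sup>+\<theta>. G (pi + \<theta>) * indicator {pi<..<2*pi} (pi + \<theta>) \<partial>lborel)"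
    unfolding G_def by (subst nn_integral_polar_upper) (auto simp: cis_mult[symmetric] indicator_def intro!: nn_integral_cong)
  also have "\<dots> = (\<integral>\<^sup>+\<theta>. G \<theta> * indicator {pi<..<2*pi} \<theta> \<partial>lborel)"
    by (subst (2) nn_integral_real_affine[where c = 1 and t = pi]) auto
  finally have lower: "(\<integral>\<^sup>+z. g z * indicator {z. Im z < 0} z \<partial>lborel) = (\<integral>\<^sup>+\<theta>. G \<theta> * indicator {pi<..<2*pi} \<theta> \<partial>lborel)" .
  have "AE z in lborel. Im z \<noteq> 0"
  proof -
    have "negligible {z. Im z = 0}"
      using negligible_hyperplane[of \<i> 0] by (simp add: inner_complex_def)
    then have "AE z in lebesgue. z \<notin> {z. Im z = 0}"
      unfolding negligible_iff_null_sets by (rule AE_not_in)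
    then have "AE z in lebesgue. Im z \<noteq> 0" by simp
    then show ?thesis by (simp add: AE_completion_iff)
  qed
  then have "(\<integral>\<^sup>+z. g z \<partial>lborel) =
     (\<integral>\<^sup>+z. g z * indicator {z. Im z > 0} z + g z * indicator {z. Im z < 0} z \<partial>lborel)"
    by (intro nn_integral_cong_AE, eventually_elim) (auto simp: indicator_def)
  also have "\<dots> = (\<integral>\<^sup>+\<theta>. G \<theta> * indicator {0<..<pi} \<theta> \<partial>lborel) + (\<integral>\<^sup>+\<theta>. G \<theta> * indicator {pi<..<2*pi} \<theta> \<partial>lborel)"
    unfolding lower[symmetric] unfolding G_def by (subst nn_integral_add) (auto simp: nn_integral_polar_upper)
  also have "\<dots> = (\<integral>\<^sup>+\<theta>. G \<theta> * indicator {0<..<pi} \<theta> + G \<theta> * indicator {pi<..<2*pi} \<theta> \<partial>lborel)"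
    by (subst nn_integral_add) auto
  also have "\<dots> = (\<integral>\<^sup>+\<theta>. G \<theta> * indicator {0..<2*pi} \<theta> \<partial>lborel)"
    using AE_lborel_singleton[of 0] AE_lborel_singleton[of pi]
    by (intro nn_integral_cong_AE, eventually_elim) (auto simp: indicator_def)
  finally show ?thesis unfolding G_def .
qed

section \<open>Weights of product form\<close>

lemma borel_measurable_Arg2pi [measurable]: "Arg2pi \<in> borel_measurable borel"
  by (rule borel_measurableI_greater) (simp add: open_Arg2pi2pi_gt)

lemma nn_integral_polar_product:
  fixes a b :: "real \<Rightarrow> ennreal"
  assumes [measurable]: "a \<in> borel_measurable borel" "b \<in> borel_measurable borel"
  shows "(\<integral>\<^sup>+z. a (cmod z) * b (Arg2pi z) \<partial>lborel) =
    (\<integral>\<^sup>+s. a s * ennreal s * indicator {0<..} s \<partial>lborel) * (\<integral>\<^sup>+\<theta>. b \<theta> * indicator {0..<2 * pi} \<theta> \<partial>lborel)"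
proof -
  have "(\<integral>\<^sup>+z. a (cmod z) * b (Arg2pi z) \<partial>lborel) =
    (\<integral>\<^sup>+\<theta>. (\<integral>\<^sup>+s. a (cmod (of_real s * cis \<theta>)) * b (Arg2pi (of_real s * cis \<theta>)) * ennreal s
        * indicator {0<..} s \<partial>lborel) * indicator {0..<2 * pi} \<theta> \<partial>lborel)"
    by (rule nn_integral_polar) measurable
  also have "\<dots> = (\<integral>\<^sup>+\<theta>. (\<integral>\<^sup>+s. a s * ennreal s * indicator {0<..} s \<partial>lborel) * (b \<theta> * indicator {0..<2 * pi} \<theta>) \<partial>lborel)"
  proof (rule nn_integral_cong)
    fix \<theta> :: real
    show "(\<integral>\<^sup>+s. a (cmod (of_real s * cis \<theta>)) * b (Arg2pi (of_real s * cis \<theta>)) * ennreal s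
          * indicator {0<..} s \<partial>lborel) * indicator {0..<2 * pi} \<theta>
       = (\<integral>\<^sup>+s. a s * ennreal s * indicator {0<..} s \<partial>lborel) * (b \<theta> * indicator {0..<2 * pi} \<theta>)"
    proof (cases "\<theta> \<in> {0..<2 * pi}")
      case True
      have "Arg2pi (of_real s * cis \<theta>) = \<theta>" if "s > 0" for s
        using that True by (intro Arg2pi_unique[of s]) (auto simp: cis_conv_exp)
      then have "(\<integral>\<^sup>+s. a (cmod (of_real s * cis \<theta>)) * b (Arg2pi (of_real s * cis \<theta>)) * ennreal s
          * indicator {0<..} s \<partial>lborel) = (\<integral>\<^sup>+s. b \<theta> * (a s * ennreal s * indicator {0<..} s) \<partial>lborel)"
        by (intro nn_integral_cong) (auto simp: indicator_def norm_mult ac_simps)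
      then show ?thesis
        using True by (simp add: nn_integral_cmult mult.commute)
    qed simp
  qed
  also have "\<dots> = (\<integral>\<^sup>+s. a s * ennreal s * indicator {0<..} s \<partial>lborel) * (\<integral>\<^sup>+\<theta>. b \<theta> * indicator {0..<2 * pi} \<theta> \<partial>lborel)"
    by (rule nn_integral_cmult) measurable
  finally show ?thesis .
qed

text \<open>Radial and angular null sets give null sets in the plane, by the product formula for their
  indicators. This makes Lebesgue measurable data in the polar variables as good as Borel data.\<close>

lemma AE_polar:
  assumes "AE s in lborel. P s" "AE \<theta> in lborel. Q \<theta>"
  shows "AE z in lborel. P (cmod z) \<and> Q (Arg2pi z)"
proof -
  obtain M where M: "{s. \<not> P s} \<subseteq> M" "M \<in> null_sets lborel"
    using assms(1) by (auto simp: eventually_ae_filter)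
  obtain N where N: "{\<theta>. \<not> Q \<theta>} \<subseteq> N" "N \<in> null_sets lborel"
    using assms(2) by (auto simp: eventually_ae_filter)
  have [measurable]: "M \<in> sets borel" "N \<in> sets borel"
    using M N by auto
  have "(\<integral>\<^sup>+s. indicator M s * ennreal s * indicator {0<..} s \<partial>lborel) = 0"
    using AE_not_in[OF M(2)] by (subst nn_integral_0_iff_AE) (auto elim!: eventually_mono)
  then have "(\<integral>\<^sup>+z. indicator M (cmod z) * 1 \<partial>(lborel :: complex measure)) = 0"
    using nn_integral_polar_product[of "indicator M" "\<lambda>_. 1"] by simp
  then have "AE z in (lborel :: complex measure). cmod z \<notin> M"
    by (subst (asm) nn_integral_0_iff_AE) (auto elim!: eventually_mono split: split_indicator_asm)
  moreover
  have "(\<integral>\<^sup>+\<theta>. indicator N \<theta> * indicator {0..<2 * pi} \<theta> \<partial>lborel) = 0"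
    using AE_not_in[OF N(2)] by (subst nn_integral_0_iff_AE) (auto elim!: eventually_mono)
  then have "(\<integral>\<^sup>+z. 1 * indicator N (Arg2pi z) \<partial>lborel) = 0"
    using nn_integral_polar_product[of "\<lambda>_. 1" "indicator N"] by simp
  then have "AE z in lborel. Arg2pi z \<notin> N"
    by (subst (asm) nn_integral_0_iff_AE) (auto elim!: eventually_mono split: split_indicator_asm)
  ultimately show ?thesis
    by eventually_elim (use M N in auto)
qed

lemma set_integrable_borel_version:
  fixes f :: "real \<Rightarrow> real"
  assumes "set_integrable lebesgue A f"
  obtains f' where "f' \<in> borel_measurable borel" "AE x in lborel. f' x = indicator A x * f x"
    "(\<integral>\<^sup>+x. ennreal \<bar>f' x\<bar> \<partial>lborel) < \<infinity>"
proof -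
  let ?f = "\<lambda>x. indicator A x * f x"
  have int: "integrable lebesgue ?f"
    using assms by (simp add: set_integrable_def)
  then obtain f' where f': "f' \<in> borel_measurable lborel" "AE x in lborel. ?f x = f' x"
    using completion_ex_borel_measurable_real[OF borel_measurable_integrable[OF int]] by blast
  have "(\<integral>\<^sup>+x. ennreal \<bar>f' x\<bar> \<partial>lborel) = (\<integral>\<^sup>+x. ennreal \<bar>?f x\<bar> \<partial>lborel)"
    using f'(2) by (intro nn_integral_cong_AE) (auto elim!: eventually_mono)
  also have "\<dots> < \<infinity>"
    using int by (simp add: integrable_iff_bounded nn_integral_completion)
  finally show ?thesis
    using f' by (intro that[of f']) (auto elim!: eventually_mono)
qed

text \<open>Both factors agree almost everywhere with Borel functions \<open>a\<close> and \<open>b\<close>. The radial one is chosen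
  for \<open>s \<omega>(s)\<close>, because \<open>\<omega>\<close> itself need not be integrable at the origin; hence the division by
  \<open>cmod z\<close> in \<open>W\<close>, which the Jacobian undoes.\<close>

lemma set_integrable_polar_product:
  fixes \<omega> v :: "real \<Rightarrow> real" and w :: "complex \<Rightarrow> real"
  assumes w: "\<And>s \<theta>. s \<in> {0<..<1} \<Longrightarrow> \<theta> \<in> {0..<2 * pi} \<Longrightarrow>
           w (of_real s * exp (\<i> * of_real \<theta>)) = \<omega> s * v \<theta>"
    and \<omega>: "set_integrable lebesgue {0<..<1} (\<lambda>s. s * \<omega> s)"
    and v: "set_integrable lebesgue {0..<2 * pi} v"
  shows "set_integrable lebesgue (ball 0 1) w"
proof -
  obtain a where [measurable]: "a \<in> borel_measurable borel"
    and a: "AE s in lborel. a s = indicator {0<..<1} s * (s * \<omega> s)"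
    and a_fin: "(\<integral>\<^sup>+s. ennreal \<bar>a s\<bar> \<partial>lborel) < \<infinity>"
    using set_integrable_borel_version[OF \<omega>] by blast
  obtain b where [measurable]: "b \<in> borel_measurable borel"
    and b: "AE \<theta> in lborel. b \<theta> = indicator {0..<2 * pi} \<theta> * v \<theta>"
    and b_fin: "(\<integral>\<^sup>+\<theta>. ennreal \<bar>b \<theta>\<bar> \<partial>lborel) < \<infinity>"
    using set_integrable_borel_version[OF v] by blast
  define W where "W z = a (cmod z) / cmod z * b (Arg2pi z)" for z
  have [measurable]: "W \<in> borel_measurable borel"
    unfolding W_def by measurable
  have "(\<integral>\<^sup>+z. ennreal (norm (W z)) \<partial>lborel) =
      (\<integral>\<^sup>+z. ennreal \<bar>a (cmod z) / cmod z\<bar> * ennreal \<bar>b (Arg2pi z)\<bar> \<partial>lborel)"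
    by (simp add: W_def abs_mult ennreal_mult[symmetric])
  also have "\<dots> = (\<integral>\<^sup>+s. ennreal \<bar>a s / s\<bar> * ennreal s * indicator {0<..} s \<partial>lborel)
       * (\<integral>\<^sup>+\<theta>. ennreal \<bar>b \<theta>\<bar> * indicator {0..<2 * pi} \<theta> \<partial>lborel)"
    by (rule nn_integral_polar_product) measurable
  also have "\<dots> \<le> (\<integral>\<^sup>+s. ennreal \<bar>a s\<bar> \<partial>lborel) * (\<integral>\<^sup>+\<theta>. ennreal \<bar>b \<theta>\<bar> \<partial>lborel)"
    by (intro mult_mono nn_integral_mono) (auto simp: indicator_def ennreal_mult[symmetric])
  also have "\<dots> < \<infinity>"
    using a_fin b_fin by (simp add: ennreal_mult_less_top)
  finally have "integrable lborel W"
    by (simp add: integrable_iff_bounded)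
  then have W: "integrable lebesgue W"
    by (simp add: integrable_completion)
  have "AE z in lborel. z \<noteq> (0 :: complex)"
    by (rule AE_lborel_singleton)
  with AE_polar[OF a b] have "AE z in lborel. indicator (ball 0 1) z * w z = W z"
  proof eventually_elim
    case (elim z)
    have Arg: "Arg2pi z \<in> {0..<2 * pi}" using Arg2pi[of z] by auto
    show ?case
    proof (cases "cmod z < 1")
      case True
      have "z = of_real (cmod z) * exp (\<i> * of_real (Arg2pi z))" by (rule Arg2pi_eq)
      then have "w z = \<omega> (cmod z) * v (Arg2pi z)"
        using w[of "cmod z" "Arg2pi z"] True elim Arg by simp
      then show ?thesis
        using True elim Arg by (simp add: W_def)
    qed (use elim in \<open>simp add: W_def\<close>)
  qed
  then have "AE z in lebesgue. indicator (ball 0 1) z * w z = W z"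
    by (rule AE_completion)
  then obtain N where N: "{z. indicator (ball 0 1) z * w z \<noteq> W z} \<subseteq> N" "N \<in> null_sets lebesgue"
    by (auto simp: eventually_ae_filter)
  have "(\<lambda>z. indicator (ball 0 1) z * w z) absolutely_integrable_on UNIV"
    by (rule absolutely_integrable_spike[where f = W and S = N])
       (use W N in \<open>auto simp: set_integrable_def negligible_iff_null_sets\<close>)
  then show ?thesis by (simp add: set_integrable_def)
qed

section \<open>Weighted powers of functions\<close>

text \<open>The factor \<open>2 powr p\<close> replaces the triangle inequality and serves all \<open>p > 0\<close> alike.\<close>

lemma cmod_diff_powr_le:
  fixes a b :: complex
  assumes "0 < p"
  shows "cmod (a - b) powr p \<le> 2 powr p * (cmod a powr p + cmod b powr p)"
proof -
  have "cmod (a - b) \<le> 2 * max (cmod a) (cmod b)"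
    using norm_triangle_ineq4[of a b] by simp
  then have "cmod (a - b) powr p \<le> (2 * max (cmod a) (cmod b)) powr p"
    using assms by (intro powr_mono2) auto
  also have "\<dots> = 2 powr p * max (cmod a) (cmod b) powr p"
    by (rule powr_mult)
  also have "max (cmod a) (cmod b) powr p \<le> cmod a powr p + cmod b powr p"
    by (simp add: max_def)
  finally show ?thesis by (simp add: mult_left_mono)
qed

lemma set_borel_measurable_cmod_powr_mult:
  fixes g :: "complex \<Rightarrow> complex" and w :: "complex \<Rightarrow> real"
  assumes "S \<in> sets borel" "set_integrable lebesgue S w" "continuous_on S g" "0 < p"
  shows "set_borel_measurable lebesgue S (\<lambda>z. cmod (g z) powr p * w z)"
proof -
  have "continuous_on S (\<lambda>z. cmod (g z) powr p)"
    using assms by (intro continuous_on_powr' continuous_intros) auto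
  with assms(1) have "(\<lambda>z. indicator S z *\<^sub>R (cmod (g z) powr p)) \<in> borel_measurable borel"
    by (rule borel_measurable_continuous_on_indicator)
  then have "(\<lambda>z. indicator S z *\<^sub>R (cmod (g z) powr p)) \<in> borel_measurable lebesgue"
    by (intro measurable_completion) simp
  moreover have "(\<lambda>z. indicator S z *\<^sub>R w z) \<in> borel_measurable lebesgue"
    using assms by (auto simp: set_integrable_def)
  ultimately have "(\<lambda>z. (indicator S z *\<^sub>R (cmod (g z) powr p)) * (indicator S z *\<^sub>R w z)) \<in> borel_measurable lebesgue"
    by (rule borel_measurable_times)
  also have "(\<lambda>z. (indicator S z *\<^sub>R (cmod (g z) powr p)) * (indicator S z *\<^sub>R w z))
     = (\<lambda>z. indicator S z *\<^sub>R (cmod (g z) powr p * w z))"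
    by (auto simp: indicator_def)
  finally show ?thesis by (simp add: set_borel_measurable_def)
qed

lemma weighted_power_bounded:
  fixes g :: "complex \<Rightarrow> complex" and w :: "complex \<Rightarrow> real"
  assumes S: "S \<in> sets borel" and w: "set_integrable lebesgue S w" "\<And>z. z \<in> S \<Longrightarrow> 0 \<le> w z"
    and g: "continuous_on S g" "\<And>z. z \<in> S \<Longrightarrow> cmod (g z) \<le> B" and p: "0 < p"
  shows "set_integrable lebesgue S (\<lambda>z. cmod (g z) powr p * w z)"
    and "(LINT z:S|lebesgue. cmod (g z) powr p * w z) \<le> B powr p * (LINT z:S|lebesgue. w z)"
proof -
  have le: "cmod (g z) powr p * w z \<le> B powr p * w z" if "z \<in> S" for z
    using that w g p by (intro mult_right_mono powr_mono2) auto
  show int: "set_integrable lebesgue S (\<lambda>z. cmod (g z) powr p * w z)"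
  proof (rule set_integrable_bound)
    show "set_integrable lebesgue S (\<lambda>z. B powr p * w z)" using w by simp
    show "set_borel_measurable lebesgue S (\<lambda>z. cmod (g z) powr p * w z)"
      using assms by (intro set_borel_measurable_cmod_powr_mult)
    show "AE z in lebesgue. z \<in> S \<longrightarrow> norm (cmod (g z) powr p * w z) \<le> norm (B powr p * w z)"
      using w le by (auto simp: abs_mult)
  qed
  have "(LINT z:S|lebesgue. cmod (g z) powr p * w z) \<le> (LINT z:S|lebesgue. B powr p * w z)"
    using le int w by (intro set_integral_mono) auto
  then show "(LINT z:S|lebesgue. cmod (g z) powr p * w z) \<le> B powr p * (LINT z:S|lebesgue. w z)"
    by simp
qed

lemma weighted_power_diff:
  fixes f g :: "complex \<Rightarrow> complex" and w :: "complex \<Rightarrow> real"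
  assumes S: "S \<in> sets borel" and w: "set_integrable lebesgue S w" "\<And>z. z \<in> S \<Longrightarrow> 0 \<le> w z"
    and f: "continuous_on S f" "set_integrable lebesgue S (\<lambda>z. cmod (f z) powr p * w z)"
    and g: "continuous_on S g" "set_integrable lebesgue S (\<lambda>z. cmod (g z) powr p * w z)" and p: "0 < p"
  shows "set_integrable lebesgue S (\<lambda>z. cmod (f z - g z) powr p * w z)"
    and "(LINT z:S|lebesgue. cmod (f z - g z) powr p * w z) \<le>
      2 powr p * ((LINT z:S|lebesgue. cmod (f z) powr p * w z) + (LINT z:S|lebesgue. cmod (g z) powr p * w z))"
proof -
  let ?h = "\<lambda>z. 2 powr p * (cmod (f z) powr p * w z + cmod (g z) powr p * w z)"
  have le: "cmod (f z - g z) powr p * w z \<le> ?h z" if "z \<in> S" for z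
    using mult_right_mono[OF cmod_diff_powr_le[OF p, of "f z" "g z"] w(2)[OF that]]
    by (simp add: algebra_simps)
  have h: "set_integrable lebesgue S ?h"
    by (intro set_integrable_mult_right impI set_integral_add(1) f g)
  show int: "set_integrable lebesgue S (\<lambda>z. cmod (f z - g z) powr p * w z)"
  proof (rule set_integrable_bound[OF h])
    show "set_borel_measurable lebesgue S (\<lambda>z. cmod (f z - g z) powr p * w z)"
      using assms by (intro set_borel_measurable_cmod_powr_mult continuous_intros) auto
    show "AE z in lebesgue. z \<in> S \<longrightarrow> norm (cmod (f z - g z) powr p * w z) \<le> norm (?h z)"
      using w le by (intro AE_I2 impI) (auto simp: abs_mult intro: order_trans[OF _ abs_ge_self])
  qed
  have "(LINT z:S|lebesgue. cmod (f z - g z) powr p * w z) \<le> (LINT z:S|lebesgue. ?h z)"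
    by (rule set_integral_mono[OF int h le])
  also have "\<dots> = 2 powr p * ((LINT z:S|lebesgue. cmod (f z) powr p * w z) + (LINT z:S|lebesgue. cmod (g z) powr p * w z))"
    using f g by (simp add: set_integral_add)
  finally show "(LINT z:S|lebesgue. cmod (f z - g z) powr p * w z) \<le>
      2 powr p * ((LINT z:S|lebesgue. cmod (f z) powr p * w z) + (LINT z:S|lebesgue. cmod (g z) powr p * w z))" .
qed

section \<open>Integrals over subsets and over scaled arguments\<close>

lemma set_integral_nonneg_real:
  fixes h :: "'a \<Rightarrow> real"
  assumes "\<And>z. z \<in> S \<Longrightarrow> 0 \<le> h z"
  shows "0 \<le> (LINT z:S|M. h z)"
  unfolding set_lebesgue_integral_def
  by (rule Bochner_Integration.integral_nonneg) (use assms in \<open>simp add: indicator_def\<close>)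

lemma set_integral_mono_set:
  fixes h :: "'a \<Rightarrow> real"
  assumes "S \<subseteq> T" "S \<in> sets M" "set_integrable M T h" "\<And>z. z \<in> T \<Longrightarrow> 0 \<le> h z"
  shows "(LINT z:S|M. h z) \<le> (LINT z:T|M. h z)"
  unfolding set_lebesgue_integral_def
proof (rule integral_mono)
  show "integrable M (\<lambda>z. indicator S z *\<^sub>R h z)" "integrable M (\<lambda>z. indicator T z *\<^sub>R h z)"
    using assms set_integrable_subset[of M T h S] by (simp_all add: set_integrable_def)
  show "indicator S z *\<^sub>R h z \<le> indicator T z *\<^sub>R h z" for z
    using assms by (cases "z \<in> S"; cases "z \<in> T") auto
qed

lemma lebesgue_scaleR:
  fixes f :: "'a::euclidean_space \<Rightarrow> real"
  assumes f: "integrable lebesgue f" and c: "0 < c"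
  shows "integrable lebesgue (\<lambda>x. f (c *\<^sub>R x))"
    and "(LINT x|lebesgue. f (c *\<^sub>R x)) = (LINT x|lebesgue. f x) / c ^ DIM('a)"
proof -
  have eq: "lebesgue = density (distr lebesgue lebesgue ((*\<^sub>R) c)) (\<lambda>_::'a. ennreal (c ^ DIM('a)))"
    using lebesgue_affine_euclidean[of "\<lambda>_::'a. c" 0] c
    unfolding scaleR_scaleR[symmetric] scaleR_sum_right[symmetric] euclidean_representation prod_constant
    by simp
  have [measurable]: "f \<in> borel_measurable lebesgue" using f by auto
  have "integrable (density (distr lebesgue lebesgue ((*\<^sub>R) c)) (\<lambda>_. ennreal (c ^ DIM('a)))) f"
    using f by (subst eq[symmetric])
  then have "integrable (distr lebesgue lebesgue ((*\<^sub>R) c)) (\<lambda>x. c ^ DIM('a) *\<^sub>R f x)"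
    using c by (subst (asm) integrable_density) auto
  then show "integrable lebesgue (\<lambda>x. f (c *\<^sub>R x))"
    using c by (subst (asm) integrable_distr_eq) auto
  have "(LINT x|lebesgue. f x) = (LINT x|density (distr lebesgue lebesgue ((*\<^sub>R) c)) (\<lambda>_. ennreal (c ^ DIM('a))). f x)"
    by (subst eq[symmetric]) simp
  also have "\<dots> = c ^ DIM('a) * (LINT x|lebesgue. f (c *\<^sub>R x))"
    using c by (subst integral_density) (auto simp: integral_distr)
  finally show "(LINT x|lebesgue. f (c *\<^sub>R x)) = (LINT x|lebesgue. f x) / c ^ DIM('a)"
    using c by simp
qed

lemma set_integral_boundary_tail:
  fixes h :: "complex \<Rightarrow> real"
  assumes h: "set_integrable lebesgue (ball 0 1) h" and \<delta>: "0 < \<delta>"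
  obtains R where "0 < R" "R < 1" "(LINT z:ball 0 1 - cball 0 R|lebesgue. h z) < \<delta>"
proof -
  define R where "R n = 1 - 1 / real (n + 2)" for n
  define A :: "nat \<Rightarrow> complex set" where "A n = ball 0 1 - cball 0 (R n)" for n
  have R: "0 < R n" "R n < 1" for n by (auto simp: R_def field_simps)
  have "R m \<le> R n" if "m \<le> n" for m n using that by (simp add: R_def frac_le)
  then have "decseq A" by (fastforce simp: decseq_def A_def)
  moreover have "A n \<in> sets lebesgue" for n
    by (simp add: A_def sets.Diff)
  moreover have "set_integrable lebesgue (A 0) h"
    by (rule set_integrable_subset[OF h]) (auto simp: A_def)
  ultimately have lim: "(\<lambda>n. LINT z:A n|lebesgue. h z) \<longlonglongrightarrow> (LINT z:(\<Inter>n. A n)|lebesgue. h z)"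
    by (intro set_integral_cont_down)
  have "(\<Inter>n. A n) = {}"
  proof -
    have "R \<longlonglongrightarrow> 1 - 0"
      unfolding R_def using LIMSEQ_ignore_initial_segment[OF lim_inverse_n', of 2]
      by (intro tendsto_intros) simp
    then have "\<exists>n. cmod z \<le> R n" if "cmod z < 1" for z
      using order_tendstoD(1)[of R 1 sequentially "cmod z"] that
      by (auto simp: eventually_sequentially intro: less_imp_le)
    then show ?thesis by (auto simp: A_def not_less)
  qed
  with lim have "(\<lambda>n. LINT z:A n|lebesgue. h z) \<longlonglongrightarrow> 0"
    by (simp add: set_lebesgue_integral_def)
  from order_tendstoD(2)[OF this \<delta>] obtain n where "(LINT z:A n|lebesgue. h z) < \<delta>"
    by (auto simp: eventually_sequentially)
  then show ?thesis using that[of "R n"] R by (simp add: A_def)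
qed

section \<open>Taylor approximation and dilations\<close>

text \<open>The approximants are Taylor polynomials: the radius of convergence at the origin is at least
  every \<open>s < 1\<close>.\<close>

lemma holomorphic_approx_poly_cball:
  assumes f: "f holomorphic_on ball 0 1" and r: "0 < r" "r < 1" and e: "0 < e"
  obtains Q :: "complex poly" where "\<And>z. z \<in> cball 0 r \<Longrightarrow> cmod (f z - poly Q z) < e"
proof -
  define a where "a n = (deriv ^^ n) f 0 / fact n" for n
  have sums: "(\<lambda>n. a n * z ^ n) sums f z" if "z \<in> ball 0 1" for z
    using holomorphic_power_series[OF f that] by (simp add: a_def)
  define s where "s = (1 + r) / 2"
  have s: "r < s" "0 < s" "s < 1" using r by (auto simp: s_def)
  have "summable (\<lambda>n. a n * of_real s ^ n)"
    by (rule sums_summable[OF sums]) (use s in simp)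
  from conv_radius_geI[OF this] have "ereal s \<le> conv_radius a"
    using s by simp
  with s have rad: "ereal r < conv_radius a"
    by (simp add: less_le_trans[of _ "ereal s"])
  from powser_uniform_limit[OF rad, of 0] e
  have "\<forall>\<^sub>F n in sequentially. \<forall>z\<in>cball 0 r. dist (\<Sum>i<n. a i * z ^ i) (\<Sum>i. a i * z ^ i) < e"
    by (simp add: uniform_limit_iff)
  then obtain n where n: "\<And>z. z \<in> cball 0 r \<Longrightarrow> dist (\<Sum>i<n. a i * z ^ i) (\<Sum>i. a i * z ^ i) < e"
    using eventually_happens'[OF sequentially_bot] by blast
  show ?thesis
  proof (rule that[of "\<Sum>i<n. monom (a i) i"])
    fix z :: complex assume z: "z \<in> cball 0 r"
    then have "(\<Sum>i. a i * z ^ i) = f z"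
      using sums[of z] r by (simp add: sums_iff)
    then show "cmod (f z - poly (\<Sum>i<n. monom (a i) i) z) < e"
      using n[OF z] by (simp add: poly_sum poly_monom dist_norm norm_minus_commute)
  qed
qed

lemma dilation_into_disc:
  fixes z :: complex
  assumes "0 < r" "r < 1" "cmod z \<le> 1"
  shows "r *\<^sub>R z \<in> cball 0 r" "r *\<^sub>R z \<in> ball 0 1"
proof -
  have "cmod (r *\<^sub>R z) \<le> r"
    using mult_left_mono[OF assms(3), of r] assms(1) by simp
  with assms show "r *\<^sub>R z \<in> cball 0 r" "r *\<^sub>R z \<in> ball 0 1"
    by (simp_all only: mem_cball_0 mem_ball_0)
qed

lemma dilation_continuous_bounded:
  fixes f :: "complex \<Rightarrow> complex"
  assumes f: "continuous_on (ball 0 1) f" and r: "0 < r" "r < 1"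
  obtains B where "continuous_on (cball 0 1) (\<lambda>z. f (r *\<^sub>R z))"
    "\<And>z. z \<in> cball 0 1 \<Longrightarrow> cmod (f (r *\<^sub>R z)) \<le> B"
proof -
  have sub: "(\<lambda>z. r *\<^sub>R z) ` cball 0 1 \<subseteq> ball (0::complex) 1"
    using dilation_into_disc(2)[OF r] by (simp add: image_subset_iff)
  have cont: "continuous_on (cball 0 1) (\<lambda>z. f (r *\<^sub>R z))"
    by (rule continuous_on_compose2[OF f _ sub]) (intro continuous_intros)
  from compact_imp_bounded[OF compact_continuous_image[OF cont compact_cball]]
  obtain B where "\<And>z. z \<in> cball 0 1 \<Longrightarrow> cmod (f (r *\<^sub>R z)) \<le> B"
    unfolding bounded_iff by blast
  with cont show ?thesis by (rule that)
qed

text \<open>Substitute \<open>\<zeta> = r z\<close>: the weight becomes \<open>w (\<zeta> / r)\<close>, which the growth condition bounds by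
  \<open>C w(\<zeta>) / r ^ k\<close>; the area element contributes \<open>1 / r\<^sup>2\<close>. The annulus \<open>R < |z| < 1\<close> becomes
  \<open>r R < |\<zeta>| < r\<close>, so that the mass of a dilate near the circle is controlled by the mass of \<open>f\<close>
  itself near the circle, uniformly for \<open>r\<close> away from \<open>0\<close>.\<close>

lemma dilation_tail_bound:
  fixes w :: "complex \<Rightarrow> real"
  assumes w: "set_integrable lebesgue (ball 0 1) w" "\<And>z. z \<in> ball 0 1 \<Longrightarrow> 0 \<le> w z"
    and growth: "\<And>z. cmod z < r \<Longrightarrow> r ^ k * w (z /\<^sub>R r) \<le> C * w z"
    and r: "0 < r" "r < 1" and C: "0 \<le> C" and p: "0 < p"
    and f: "f \<in> bergman_space p w"
  shows "(LINT z:ball 0 1 - cball 0 R|lebesgue. cmod (f (r *\<^sub>R z)) powr p * w z) \<le>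
    C / r ^ (k + 2) * (LINT z:ball 0 1 - cball 0 (r * R)|lebesgue. cmod (f z) powr p * w z)"
proof -
  let ?A = "ball 0 1 - cball 0 R :: complex set"
  have cont: "continuous_on (ball 0 1) f" and int: "set_integrable lebesgue (ball 0 1) (\<lambda>z. cmod (f z) powr p * w z)"
    using f by (auto simp: bergman_space_def intro: holomorphic_on_imp_continuous_on)
  obtain B where contr: "continuous_on (cball 0 1) (\<lambda>z. f (r *\<^sub>R z))"
    and B: "\<And>z. z \<in> cball 0 1 \<Longrightarrow> cmod (f (r *\<^sub>R z)) \<le> B"
    using dilation_continuous_bounded[OF cont r] by blast
  have wA: "set_integrable lebesgue ?A w"
    by (rule set_integrable_subset[OF w(1)]) auto
  have intA: "set_integrable lebesgue ?A (\<lambda>z. cmod (f (r *\<^sub>R z)) powr p * w z)"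
    by (rule weighted_power_bounded(1)[where B = B])
       (use wA w p B in \<open>auto intro!: continuous_on_subset[OF contr]\<close>)
  define H where "H z = indicator (ball 0 1 - cball 0 (r * R)) z * (cmod (f z) powr p * w z)" for z
  have H: "integrable lebesgue H"
    using set_integrable_subset[OF int, of "ball 0 1 - cball 0 (r * R)"]
    unfolding H_def by (auto simp: set_integrable_def)
  note HS = lebesgue_scaleR[OF H r(1)]
  have "(LINT z:?A|lebesgue. cmod (f (r *\<^sub>R z)) powr p * w z)
     = (LINT z|lebesgue. indicator ?A z *\<^sub>R (cmod (f (r *\<^sub>R z)) powr p * w z))"
    by (simp add: set_lebesgue_integral_def)
  also have "\<dots> \<le> (LINT z|lebesgue. C / r ^ k * H (r *\<^sub>R z))"
  proof (rule integral_mono)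
    show "integrable lebesgue (\<lambda>z. indicator ?A z *\<^sub>R (cmod (f (r *\<^sub>R z)) powr p * w z))"
      using intA by (simp add: set_integrable_def)
    show "integrable lebesgue (\<lambda>z. C / r ^ k * H (r *\<^sub>R z))"
      using HS by simp
    fix z :: complex
    show "indicator ?A z *\<^sub>R (cmod (f (r *\<^sub>R z)) powr p * w z) \<le> C / r ^ k * H (r *\<^sub>R z)"
    proof (cases "cmod z < 1")
      case True
      then have rz: "cmod (r *\<^sub>R z) < r" using r by simp
      have "r ^ k * w z \<le> C * w (r *\<^sub>R z)"
        using growth[OF rz] r by simp
      then have "w z \<le> C / r ^ k * w (r *\<^sub>R z)"
        using r by (simp add: field_simps)
      then have le: "cmod (f (r *\<^sub>R z)) powr p * w z \<le> C / r ^ k * (cmod (f (r *\<^sub>R z)) powr p * w (r *\<^sub>R z))"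
        using mult_left_mono[of "w z" "C / r ^ k * w (r *\<^sub>R z)" "cmod (f (r *\<^sub>R z)) powr p"] by (simp add: ac_simps)
      have "r *\<^sub>R z \<in> ball 0 1 - cball 0 (r * R) \<longleftrightarrow> z \<in> ?A"
        using r less_trans[OF rz r(2)] True by (auto simp: mult_le_cancel_left)
      then show ?thesis using le by (simp add: H_def indicator_def)
    next
      case False
      have "0 \<le> C / r ^ k * H (r *\<^sub>R z)"
        using r w(2)[of "r *\<^sub>R z"] C by (auto simp: H_def indicator_def)
      then show ?thesis using False by (simp add: indicator_def)
    qed
  qed
  also have "\<dots> = C / r ^ (k + 2) * (LINT z:ball 0 1 - cball 0 (r * R)|lebesgue. cmod (f z) powr p * w z)"
    using HS(2) by (simp add: H_def set_lebesgue_integral_def power_add power2_eq_square ac_simps)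
  finally show ?thesis .
qed

section \<open>Density of polynomials\<close>

lemma poly_in_bergman_space:
  assumes "set_integrable lebesgue (ball 0 1) w" "\<And>z. z \<in> ball 0 1 \<Longrightarrow> 0 \<le> w z" "0 < p"
  shows "poly Q \<in> bergman_space p w"
proof -
  have cont: "continuous_on S (poly Q)" for S :: "complex set"
    by (intro continuous_intros)
  obtain B where "\<And>z. z \<in> cball 0 1 \<Longrightarrow> cmod (poly Q z) \<le> B"
    using compact_imp_bounded[OF compact_continuous_image[OF cont compact_cball[of 0 1]]]
    unfolding bounded_iff by blast
  then have "set_integrable lebesgue (ball 0 1) (\<lambda>z. cmod (poly Q z) powr p * w z)"
    using assms cont by (intro weighted_power_bounded(1)[where B = B]) auto
  then show ?thesis
    by (auto simp: bergman_space_def intro!: holomorphic_intros)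
qed

text \<open>The disc is cut at a radius \<open>R\<close>. Outside, both \<open>f\<close> and its dilate carry little mass by the
  tail bound; inside, the dilate is uniformly close to \<open>f\<close>, and \<open>w\<close> is integrable. The tail bound
  involves \<open>f\<close> on \<open>|z| > r R\<close>; taking \<open>R\<close> to be the square root of a radius \<open>R\<^sub>0\<close> beyond
  which \<open>f\<close> has small mass, and \<open>r \<ge> R\<close>, keeps \<open>r R \<ge> R\<^sub>0\<close> while \<open>R\<close> does not depend
  on \<open>r\<close>.\<close>

lemma dilation_arbitrarily_close:
  fixes w :: "complex \<Rightarrow> real"
  assumes w: "set_integrable lebesgue (ball 0 1) w" "\<And>z. z \<in> ball 0 1 \<Longrightarrow> 0 \<le> w z"
    and growth: "\<And>r z. r \<in> {r\<^sub>0..<1} \<Longrightarrow> cmod z < r \<Longrightarrow> r ^ k * w (z /\<^sub>R r) \<le> C * w z"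
    and r\<^sub>0: "r\<^sub>0 \<in> {0<..<1}" and C: "0 \<le> C" and p: "0 < p"
    and f: "f \<in> bergman_space p w" and \<eta>: "0 < \<eta>"
  obtains r where "0 < r" "r < 1"
    "set_integrable lebesgue (ball 0 1) (\<lambda>z. cmod (f z - f (r *\<^sub>R z)) powr p * w z)"
    "(LINT z:ball 0 1|lebesgue. cmod (f z - f (r *\<^sub>R z)) powr p * w z) < \<eta>"
proof -
  let ?D = "ball 0 1 :: complex set"
  let ?F = "\<lambda>z. cmod (f z) powr p * w z"
  have cont: "continuous_on ?D f" and int: "set_integrable lebesgue ?D ?F"
    using f by (auto simp: bergman_space_def intro: holomorphic_on_imp_continuous_on)
  define W where "W = (LINT z:?D|lebesgue. w z)"
  have W: "0 \<le> W" unfolding W_def using w(2) by (rule set_integral_nonneg_real)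
  define K where "K = C / r\<^sub>0 ^ (k + 2)"
  have K: "0 \<le> K" using C r\<^sub>0 by (simp add: K_def)
  \<comment> \<open>\<open>\<delta>\<close> bounds the mass of \<open>f\<close> near the circle and \<open>e\<close> the uniform error inside; each
    part of the disc then contributes at most \<open>\<eta> / 4\<close>.\<close>
  define \<delta> where "\<delta> = \<eta> / (4 * 2 powr p * (1 + K))"
  have \<delta>: "0 < \<delta>" using \<eta> K by (auto simp: \<delta>_def intro!: divide_pos_pos mult_pos_pos)
  define e where "e = (\<eta> / (4 * (W + 1))) powr (1 / p)"
  have e: "0 < e" "e powr p = \<eta> / (4 * (W + 1))"
    using \<eta> W p by (auto simp: e_def powr_powr)
  obtain R\<^sub>0 where R\<^sub>0: "0 < R\<^sub>0" "R\<^sub>0 < 1" "(LINT z:?D - cball 0 R\<^sub>0|lebesgue. ?F z) < \<delta>"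
    using set_integral_boundary_tail[OF int \<delta>] by blast
  define R where "R = sqrt R\<^sub>0"
  have R: "0 < R" "R < 1" "R * R = R\<^sub>0" using R\<^sub>0 by (auto simp: R_def)
  have "uniformly_continuous_on (cball 0 R) f"
    using R by (intro compact_uniformly_continuous continuous_on_subset[OF cont]) auto
  then obtain d where d: "0 < d" "\<And>y z. y \<in> cball 0 R \<Longrightarrow> z \<in> cball 0 R \<Longrightarrow> dist z y < d \<Longrightarrow> dist (f z) (f y) < e"
    using e unfolding uniformly_continuous_on_def by metis
  define r where "r = max (max r\<^sub>0 R) (1 - d / 2)"
  have r: "0 < r" "r < 1" "r\<^sub>0 \<le> r" "R \<le> r" "1 - r < d"
    using r\<^sub>0 R d by (auto simp: r_def)
  have rR: "R\<^sub>0 \<le> r * R" "r * R \<le> R"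
    using r R by (auto simp flip: R(3))
  let ?g = "\<lambda>z. f (r *\<^sub>R z)"
  obtain B where contg: "continuous_on (cball 0 1) ?g"
    and B: "\<And>z. z \<in> cball 0 1 \<Longrightarrow> cmod (?g z) \<le> B"
    using dilation_continuous_bounded[OF cont r(1,2)] by blast
  have contgD: "continuous_on ?D ?g" by (rule continuous_on_subset[OF contg]) auto
  have intg: "set_integrable lebesgue ?D (\<lambda>z. cmod (?g z) powr p * w z)"
    using w p B contgD by (intro weighted_power_bounded(1)[where B = B]) auto
  let ?G = "\<lambda>z. cmod (f z - ?g z) powr p * w z"
  have intG: "set_integrable lebesgue ?D ?G"
    by (rule weighted_power_diff(1)[OF _ w cont int contgD intg p]) auto
  let ?A = "?D - cball 0 R"
  have inner: "(LINT z:cball 0 R|lebesgue. ?G z) \<le> e powr p * W"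
  proof -
    have "(LINT z:cball 0 R|lebesgue. ?G z) \<le> e powr p * (LINT z:cball 0 R|lebesgue. w z)"
    proof (rule weighted_power_bounded(2))
      show "set_integrable lebesgue (cball 0 R) w"
        using R by (intro set_integrable_subset[OF w(1)]) auto
      show "continuous_on (cball 0 R) (\<lambda>z. f z - ?g z)"
        using R by (intro continuous_intros continuous_on_subset[OF cont] continuous_on_subset[OF contgD]) auto
      fix z :: complex assume z: "z \<in> cball 0 R"
      show "0 \<le> w z" using z R w(2) by auto
      have "r * cmod z \<le> 1 * cmod z" using r by (intro mult_right_mono) auto
      then have rz: "r *\<^sub>R z \<in> cball 0 R" using z r by auto
      have "z - r *\<^sub>R z = (1 - r) *\<^sub>R z" by (simp add: algebra_simps)
      then have "dist z (r *\<^sub>R z) = (1 - r) * cmod z" using r by (simp add: dist_norm)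
      also have "\<dots> \<le> (1 - r) * 1" using z r R by (intro mult_left_mono) auto
      finally have "dist z (r *\<^sub>R z) < d" using r by simp
      from d(2)[OF rz z this] show "cmod (f z - ?g z) \<le> e" by (simp add: dist_norm)
    qed (use p in auto)
    also have "\<dots> \<le> e powr p * W"
      unfolding W_def using R w by (intro mult_left_mono set_integral_mono_set) auto
    finally show ?thesis .
  qed
  have T: "(LINT z:?D - cball 0 (r * R)|lebesgue. ?F z) < \<delta>"
  proof -
    have "(LINT z:?D - cball 0 (r * R)|lebesgue. ?F z) \<le> (LINT z:?D - cball 0 R\<^sub>0|lebesgue. ?F z)"
      using rR w by (intro set_integral_mono_set set_integrable_subset[OF int]) auto
    then show ?thesis using R\<^sub>0 by simp
  qed
  have outer: "(LINT z:?A|lebesgue. ?G z) \<le> 2 powr p * ((1 + K) * \<delta>)"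
  proof -
    have T0: "0 \<le> (LINT z:?D - cball 0 (r * R)|lebesgue. ?F z)"
      using w(2) by (intro set_integral_nonneg_real) auto
    have "(LINT z:?A|lebesgue. cmod (?g z) powr p * w z) \<le> C / r ^ (k + 2) * (LINT z:?D - cball 0 (r * R)|lebesgue. ?F z)"
      by (rule dilation_tail_bound[OF w growth r(1,2) C p f]) (use r in auto)
    also have "\<dots> \<le> K * \<delta>"
    proof (rule mult_mono)
      show "C / r ^ (k + 2) \<le> K"
        unfolding K_def using C r r\<^sub>0 by (intro divide_left_mono power_mono mult_pos_pos zero_less_power) auto
    qed (use T T0 K in auto)
    finally have 1: "(LINT z:?A|lebesgue. cmod (?g z) powr p * w z) \<le> K * \<delta>" .
    have "(LINT z:?A|lebesgue. ?F z) \<le> (LINT z:?D - cball 0 (r * R)|lebesgue. ?F z)"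
      using rR w by (intro set_integral_mono_set set_integrable_subset[OF int]) auto
    with T have 2: "(LINT z:?A|lebesgue. ?F z) \<le> \<delta>" by simp
    have "(LINT z:?A|lebesgue. ?G z) \<le> 2 powr p * ((LINT z:?A|lebesgue. ?F z) + (LINT z:?A|lebesgue. cmod (?g z) powr p * w z))"
      by (rule weighted_power_diff(2))
         (use w p in \<open>auto intro: set_integrable_subset[OF int] set_integrable_subset[OF intg] set_integrable_subset[OF w(1)]
           continuous_on_subset[OF cont] continuous_on_subset[OF contgD]\<close>)
    also have "\<dots> \<le> 2 powr p * ((1 + K) * \<delta>)"
      using 1 2 by (intro mult_left_mono) (auto simp: algebra_simps)
    finally show ?thesis .
  qed
  have D: "?D = cball 0 R \<union> ?A" using R by auto
  have "(LINT z:?D|lebesgue. ?G z) = (LINT z:cball 0 R|lebesgue. ?G z) + (LINT z:?A|lebesgue. ?G z)"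
    by (subst D, rule set_integral_Un) (use R in \<open>auto intro!: set_integrable_subset[OF intG]\<close>)
  also have "\<dots> \<le> e powr p * W + 2 powr p * ((1 + K) * \<delta>)"
    using inner outer by simp
  also have "2 powr p * ((1 + K) * \<delta>) = \<eta> / 4"
  proof -
    have "1 + K \<noteq> 0" using K by simp
    then show ?thesis by (simp add: \<delta>_def)
  qed
  also have "e powr p * W \<le> \<eta> / 4"
    unfolding e(2) using W \<eta> by (simp add: field_simps)
  finally have "(LINT z:?D|lebesgue. ?G z) < \<eta>" using \<eta> by simp
  then show ?thesis using that r intG by blast
qed

text \<open>A dilate close to \<open>f\<close> in norm is continuous up to the circle; approximating \<open>f\<close> by \<open>Q\<close>
  uniformly on \<open>|z| \<le> r\<close> approximates the dilate by the polynomial \<open>Q (r z)\<close> uniformly on the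
  disc, hence in norm.\<close>

theorem polynomials_dense_of_dilation_bound:
  fixes w :: "complex \<Rightarrow> real"
  assumes w: "set_integrable lebesgue (ball 0 1) w" "\<And>z. z \<in> ball 0 1 \<Longrightarrow> 0 \<le> w z"
    and growth: "\<And>r z. r \<in> {r\<^sub>0..<1} \<Longrightarrow> cmod z < r \<Longrightarrow> r ^ k * w (z /\<^sub>R r) \<le> C * w z"
    and r\<^sub>0: "r\<^sub>0 \<in> {0<..<1}" and C: "0 \<le> C" and p: "0 < p"
  shows "polynomials_dense p w"
  unfolding polynomials_dense_def
proof (intro ballI allI impI)
  fix f \<epsilon> assume f: "f \<in> bergman_space p w" and \<epsilon>: "(0::real) < \<epsilon>"
  let ?D = "ball 0 1 :: complex set"
  have holo: "f holomorphic_on ?D" and cont: "continuous_on ?D f"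
    and int: "set_integrable lebesgue ?D (\<lambda>z. cmod (f z) powr p * w z)"
    using f by (auto simp: bergman_space_def intro: holomorphic_on_imp_continuous_on)
  define W where "W = (LINT z:?D|lebesgue. w z)"
  have W: "0 \<le> W"
    unfolding W_def using w(2) by (rule set_integral_nonneg_real)
  define \<eta> where "\<eta> = \<epsilon> powr p / (2 * 2 powr p)"
  have \<eta>: "0 < \<eta>" using \<epsilon> by (simp add: \<eta>_def)
  obtain r where r: "0 < r" "r < 1"
    and intG: "set_integrable lebesgue ?D (\<lambda>z. cmod (f z - f (r *\<^sub>R z)) powr p * w z)"
    and G: "(LINT z:?D|lebesgue. cmod (f z - f (r *\<^sub>R z)) powr p * w z) < \<eta>"
    using dilation_arbitrarily_close[OF w growth r\<^sub>0 C p f \<eta>] by blast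
  define e where "e = (\<eta> / (W + 1)) powr (1 / p)"
  have e: "0 < e" "e powr p = \<eta> / (W + 1)"
    using \<eta> W p by (auto simp: e_def powr_powr)
  obtain Q where Q: "\<And>z. z \<in> cball 0 r \<Longrightarrow> cmod (f z - poly Q z) < e"
    using holomorphic_approx_poly_cball[OF holo r e(1)] by blast
  define P where "P = pcompose Q [:0, of_real r:]"
  have P: "poly P z = poly Q (r *\<^sub>R z)" for z
    by (simp add: P_def poly_pcompose scaleR_conv_of_real mult.commute)
  have PQ: "poly P \<in> bergman_space p w"
    using w p by (rule poly_in_bergman_space)
  have contP: "continuous_on ?D (poly P)" by (intro continuous_intros)
  have rD: "r *\<^sub>R z \<in> cball 0 r" if "z \<in> ?D" for z
    using that r by (intro dilation_into_disc) auto
  obtain B where "continuous_on (cball 0 1) (\<lambda>z. f (r *\<^sub>R z))"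
    using dilation_continuous_bounded[OF cont r] by blast
  then have contg: "continuous_on ?D (\<lambda>z. f (r *\<^sub>R z))"
    by (rule continuous_on_subset) auto
  let ?h = "\<lambda>z. poly P z - f (r *\<^sub>R z)"
  have conth: "continuous_on ?D ?h" by (intro continuous_on_diff contP contg)
  have h: "cmod (?h z) \<le> e" if "z \<in> ?D" for z
    using Q[of "r *\<^sub>R z"] rD[OF that] by (simp add: P norm_minus_commute)
  note H = weighted_power_bounded[OF _ w conth h p, simplified]
  \<comment> \<open>The error splits as \<open>f - P = (f - f\<^sub>r) - (P - f\<^sub>r)\<close> with \<open>f\<^sub>r(z) = f (r z)\<close>.\<close>
  have diff: "f z - f (r *\<^sub>R z) - ?h z = f z - poly P z" for z by simp
  have contG: "continuous_on ?D (\<lambda>z. f z - f (r *\<^sub>R z))" by (intro continuous_on_diff cont contg)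
  note I = weighted_power_diff[OF _ w contG intG conth H(1) p, unfolded diff, simplified]
  have mem: "(\<lambda>z. f z - poly P z) \<in> bergman_space p w"
    using I(1) holo by (auto simp: bergman_space_def intro!: holomorphic_intros)
  define N where "N = (LINT z:?D|lebesgue. cmod (f z - poly P z) powr p * w z)"
  have "N \<le> 2 powr p * ((LINT z:?D|lebesgue. cmod (f z - f (r *\<^sub>R z)) powr p * w z) + (LINT z:?D|lebesgue. cmod (?h z) powr p * w z))"
    unfolding N_def by (rule I(2))
  also have "\<dots> < 2 powr p * (\<eta> + \<eta>)"
  proof (intro mult_strict_left_mono add_less_le_mono G)
    have "(LINT z:?D|lebesgue. cmod (?h z) powr p * w z) \<le> e powr p * W"
      unfolding W_def by (rule H(2))
    also have "\<dots> \<le> \<eta>"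
      unfolding e(2) using W \<eta> by (simp add: field_simps)
    finally show "(LINT z:?D|lebesgue. cmod (?h z) powr p * w z) \<le> \<eta>" .
  qed simp
  also have "\<dots> = \<epsilon> powr p" by (simp add: \<eta>_def)
  finally have "N < \<epsilon> powr p" .
  moreover have "0 \<le> N"
    unfolding N_def using w(2) by (intro set_integral_nonneg_real) auto
  ultimately have "N powr (1 / p) < (\<epsilon> powr p) powr (1 / p)"
    using p by (intro powr_less_mono2) auto
  then have "bergman_norm p w (\<lambda>z. f z - poly P z) < \<epsilon>"
    using \<epsilon> p by (simp add: bergman_norm_def N_def powr_powr)
  with PQ mem show "\<exists>Q. poly Q \<in> bergman_space p w \<and> (\<lambda>z. f z - poly Q z) \<in> bergman_space p w \<and>
      bergman_norm p w (\<lambda>z. f z - poly Q z) < \<epsilon>"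
    by blast
qed

lemma polynomials_dense_cong:
  assumes "\<And>z. z \<in> ball 0 1 - {0} \<Longrightarrow> w z = w' z"
  shows "polynomials_dense p w \<longleftrightarrow> polynomials_dense p w'"
proof -
  have "set_integrable lebesgue (ball 0 1) (\<lambda>z. cmod (f z) powr p * w z) \<longleftrightarrow>
      set_integrable lebesgue (ball 0 1) (\<lambda>z. cmod (f z) powr p * w' z)" for f :: "complex \<Rightarrow> complex"
    unfolding set_integrable_def using assms
    by (intro integrable_discrete_difference[where X = "{0}"]) (auto simp: indicator_def)
  moreover have "(LINT z:ball 0 1|lebesgue. cmod (f z) powr p * w z) =
      (LINT z:ball 0 1|lebesgue. cmod (f z) powr p * w' z)" for f :: "complex \<Rightarrow> complex"
    unfolding set_lebesgue_integral_def using assms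
    by (intro integral_discrete_difference[where X = "{0}"]) (auto simp: indicator_def)
  ultimately have "bergman_space p w = bergman_space p w'" "bergman_norm p w = bergman_norm p w'"
    by (simp_all add: bergman_space_def bergman_norm_def fun_eq_iff)
  then show ?thesis by (simp add: polynomials_dense_def)
qed

theorem theorem2p11:
  fixes \<omega> v :: "real \<Rightarrow> real" and w :: "complex \<Rightarrow> real"
    and k :: nat and C r\<^sub>0 p :: real
  assumes "\<omega> \<in> borel_measurable (lebesgue_on {0<..<1})"
    and "\<And>s. s \<in> {0<..<1} \<Longrightarrow> \<omega> s > 0"
    and "v \<in> borel_measurable (lebesgue_on {0..<2 * pi})"
    and "\<And>\<theta>. \<theta> \<in> {0..<2 * pi} \<Longrightarrow> v \<theta> > 0"
    and "\<And>s \<theta>. s \<in> {0<..<1} \<Longrightarrow> \<theta> \<in> {0..<2 * pi} \<Longrightarrow>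
           w (of_real s * exp (\<i> * of_real \<theta>)) = \<omega> s * v \<theta>"
    and "set_integrable lebesgue {0<..<1} (\<lambda>s. s * \<omega> s)"
    and "set_integrable lebesgue {0..<2 * pi} v"
    and "r\<^sub>0 \<in> {0<..<1}"
    and "\<And>r s. r \<in> {r\<^sub>0..<1} \<Longrightarrow> 0 < s \<Longrightarrow> s < r \<Longrightarrow> r ^ k * \<omega> (s / r) \<le> C * \<omega> s"
    and "0 < p"
  shows "polynomials_dense p w"
proof -
  \<comment> \<open>The value of \<open>w\<close> at the origin is arbitrary, even possibly negative; it is set to \<open>0\<close> so that
    nonnegativity and the growth condition hold on the whole disc. Passing from \<open>C\<close>
    to \<open>\<bar>C\<bar>\<close> only weakens that condition.\<close>
  define w' where "w' z = (if z = 0 then 0 else w z)" for z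
  have Arg: "Arg2pi z \<in> {0..<2 * pi}" for z
    using Arg2pi[of z] by auto
  have polar: "w' z = \<omega> s * v (Arg2pi z)"
    if "z = of_real s * exp (\<i> * of_real (Arg2pi z))" "s \<in> {0<..<1}" for z s
    using assms(5)[OF that(2) Arg[of z]] that by (auto simp: w'_def)
  have w'_eq: "w' z = \<omega> (cmod z) * v (Arg2pi z)" if "z \<in> ball 0 1 - {0}" for z
    using that by (intro polar Arg2pi_eq) auto
  have int: "set_integrable lebesgue (ball 0 1) w'"
    by (rule set_integrable_polar_product[OF _ assms(6,7)]) (simp add: w'_def assms(5))
  have nonneg: "0 \<le> w' z" if "z \<in> ball 0 1" for z
  proof (cases "z = 0")
    case False
    then show ?thesis
      using that Arg[of z] assms(2)[of "cmod z"] assms(4)[of "Arg2pi z"] by (simp add: w'_eq)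
  qed (simp add: w'_def)
  have growth: "r ^ k * w' (z /\<^sub>R r) \<le> \<bar>C\<bar> * w' z" if r: "r \<in> {r\<^sub>0..<1}" and z: "cmod z < r" for r z
  proof (cases "z = 0")
    case False
    have r0: "0 < r" using r assms(8) by auto
    have v: "0 < v (Arg2pi z)" using assms(4) Arg by blast
    have "z /\<^sub>R r = of_real (cmod z / r) * exp (\<i> * of_real (Arg2pi z))"
      by (subst Arg2pi_eq[of z]) (simp add: scaleR_conv_of_real field_simps)
    moreover have "Arg2pi (z /\<^sub>R r) = Arg2pi z"
      using r0 Arg2pi_divide_of_real[of r z] by (simp add: scaleR_conv_of_real field_simps)
    ultimately have "w' (z /\<^sub>R r) = \<omega> (cmod z / r) * v (Arg2pi z)"
      using polar[of "z /\<^sub>R r" "cmod z / r"] False z r0 by simp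
    then have "r ^ k * w' (z /\<^sub>R r) = (r ^ k * \<omega> (cmod z / r)) * v (Arg2pi z)" by simp
    also have "\<dots> \<le> (C * \<omega> (cmod z)) * v (Arg2pi z)"
      using assms(9)[OF r, of "cmod z"] False z v by (intro mult_right_mono) auto
    also have "\<dots> = C * w' z"
      using False z r by (simp add: w'_eq)
    also have "\<dots> \<le> \<bar>C\<bar> * w' z"
      using z r by (intro mult_right_mono nonneg) auto
    finally show ?thesis .
  qed (simp add: w'_def)
  have "polynomials_dense p w'"
    by (rule polynomials_dense_of_dilation_bound[OF int nonneg growth assms(8) _ assms(10)]) auto
  then show ?thesis
    using polynomials_dense_cong[of w' w p] by (simp add: w'_def)
qed

end
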